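(* For every integer $k$ and every integer $n\ge 3$, \[ a(n,k) = \begin{cases} a(n-1,k)+2a(n-2,k)-a(n-2+k,k) & \text{if } k\le 0,\\ a(n-1,k)+a(n-2,k)-a(n-3,k)+a(n-3-k,k) & \text{if } k\ge 0.\end{cases}\]
   Context: For an integer $k$ and a nonnegative integer $n$, $A(n,k)$ is the set of compositions $(c_1,\ldots,c_t)$ of $n$ (finite sequences of positive integers summing to $n$) such that $c_{2i-1} > c_{2i}+k$ for every $i$ with $2i\le t$ (no condition on the last part if $t$ is odd), and $a(n,k)=|A(n,k)|$. Conventions: $a(0,k)=1$ (the empty composition) and $a(m,k)=0$ for $m<0$. *)

theory Defs
  imports Complex_Main
begin

definition compositions :: "nat \<Rightarrow> nat list set" where
  "compositions n = {c. (\<forall>x\<in>set c. 0 < x) \<and> sum_list c = n}"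

(* Lists are indexed from 0, so c ! (2*i - 2) and c ! (2*i - 1) are the parts of
   1-based index 2i-1 and 2i.  The comparison is made in int because k may be negative. *)
definition A_set :: "nat \<Rightarrow> int \<Rightarrow> nat list set" where
  "A_set n k = {c \<in> compositions n.
     \<forall>i\<ge>1. 2 * i \<le> length c \<longrightarrow> int (c ! (2 * i - 2)) > int (c ! (2 * i - 1)) + k}"

(* The first argument is an integer, so that the convention a(m,k) = 0 for m < 0 can be
   stated; values are integers to avoid truncated subtraction. *)
definition a_num :: "int \<Rightarrow> int \<Rightarrow> int" where
  "a_num n k = (if n < 0 then 0 else int (card (A_set (nat n) k)))"

lemma finite_compositions: "finite (compositions n)"
proof (rule finite_subset)
  show "compositions n \<subseteq> {c. set c \<subseteq> {..n} \<and> length c \<le> n}"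
  proof
    fix c assume "c \<in> compositions n"
    then have pos: "\<forall>x\<in>set c. 0 < x" and s: "sum_list c = n"
      by (auto simp: compositions_def)
    have "length c \<le> sum_list c"
      using pos by (induction c) auto
    moreover have "\<forall>x\<in>set c. x \<le> n"
      using s member_le_sum_list by blast
    ultimately show "c \<in> {c. set c \<subseteq> {..n} \<and> length c \<le> n}"
      using s by auto
  qed
  show "finite {c. set c \<subseteq> {..n} \<and> length c \<le> n}"
    by (rule finite_lists_length_le) simp
qed

lemma finite_A_set: "finite (A_set n k)"
  by (rule finite_subset[OF _ finite_compositions[of n]]) (auto simp: A_set_def)

lemma a_num_0: "a_num 0 k = 1"
proof -
  have "c = []" if "\<forall>x\<in>set c. 0 < x" "sum_list c = 0" for c :: "nat list"
    using that by (cases c) auto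
  then have "A_set 0 k = {[]}"
    by (auto simp: A_set_def compositions_def)
  then show ?thesis by (simp add: a_num_def)
qed

end

theory Submission imports Defs begin

text \<open>An element of \<open>A(n,k)\<close> with at least two parts is an admissible pair \<open>(x,y)\<close> followed by an
  arbitrary element of \<open>A(n-x-y,k)\<close>, and for each \<open>n \<ge> 0\<close> exactly one element has fewer parts.
  For \<open>k \<ge> 0\<close> the admissible pairs form the lattice cone with apex \<open>(k+2,1)\<close> and directions
  \<open>(1,0)\<close>, \<open>(1,1)\<close>; for \<open>k \<le> 0\<close> they form the quadrant minus the cone with apex \<open>(1,1-k)\<close> and
  directions \<open>(0,1)\<close>, \<open>(1,1)\<close>. The weighted sum over a cone satisfies a linear recurrence, since
  applying the difference operators of its two directions leaves only the term of the apex.\<close>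

text \<open>The cut-off keeps the index set finite; for \<open>f\<close> vanishing at negative
  arguments it drops only zero terms.\<close>

definition pair_sum :: "(int \<Rightarrow> int) \<Rightarrow> (nat \<times> nat) set \<Rightarrow> int \<Rightarrow> int" where
  "pair_sum f Q n = (\<Sum>(x, y)\<in>{(x, y) \<in> Q. int x + int y \<le> n}. f (n - int x - int y))"

definition shift :: "nat \<Rightarrow> nat \<Rightarrow> (nat \<times> nat) set \<Rightarrow> (nat \<times> nat) set" where
  "shift i j Q = (\<lambda>(x, y). (x + i, y + j)) ` Q"

lemma mem_shift: "(x, y) \<in> shift i j Q \<longleftrightarrow> i \<le> x \<and> j \<le> y \<and> (x - i, y - j) \<in> Q"
  by (force simp: shift_def image_iff)

lemma finite_pairs_le: "finite {(x, y) \<in> Q. int x + int y \<le> n}"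
  by (rule finite_subset[of _ "{..nat n} \<times> {..nat n}"]) auto

lemma pair_sum_Un:
  assumes "P \<inter> Q = {}"
  shows "pair_sum f (P \<union> Q) n = pair_sum f P n + pair_sum f Q n"
proof -
  have "{(x, y) \<in> P \<union> Q. int x + int y \<le> n}
      = {(x, y) \<in> P. int x + int y \<le> n} \<union> {(x, y) \<in> Q. int x + int y \<le> n}"
    by auto
  then show ?thesis
    unfolding pair_sum_def
    by (simp only:) (rule sum.union_disjoint, use assms in \<open>auto intro: finite_pairs_le\<close>)
qed

lemma pair_sum_shift: "pair_sum f (shift i j Q) n = pair_sum f Q (n - int i - int j)"
  unfolding pair_sum_def
  by (rule sum.reindex_bij_witness[of _ "\<lambda>(x, y). (x + i, y + j)" "\<lambda>(x, y). (x - i, y - j)"])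
     (auto simp: mem_shift algebra_simps)

lemma pair_sum_singleton:
  assumes "\<And>m. m < 0 \<Longrightarrow> f m = 0"
  shows "pair_sum f {(x, y)} n = f (n - int x - int y)"
proof -
  have "{(x', y'). (x', y') \<in> {(x, y)} \<and> int x' + int y' \<le> n}
      = (if int x + int y \<le> n then {(x, y)} else {})"
    by auto
  then show ?thesis
    unfolding pair_sum_def using assms[of "n - int x - int y"] by auto
qed

text \<open>The hypotheses encode a cone by self-similarity: removing the ray \<open>D\<close> from
  \<open>P\<close> leaves a translate of \<open>P\<close>, and removing the apex from
  \<open>D\<close> leaves a translate of \<open>D\<close>. Each disjoint splitting becomes a
  difference equation, because translating a set by \<open>(i, j)\<close> delays its sum by
  \<open>i + j\<close>.\<close>

lemma pair_sum_cone:
  assumes f: "\<And>m. m < 0 \<Longrightarrow> f m = 0"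
    and P: "P = D \<union> shift i j P" "D \<inter> shift i j P = {}"
    and D: "D = {(x, y)} \<union> shift i' j' D" "{(x, y)} \<inter> shift i' j' D = {}"
  shows "pair_sum f P n - pair_sum f P (n - int (i + j)) - pair_sum f P (n - int (i' + j'))
       + pair_sum f P (n - int (i' + j') - int (i + j)) = f (n - int x - int y)"
proof -
  have PD: "pair_sum f P m = pair_sum f D m + pair_sum f P (m - int (i + j))" for m
    using pair_sum_Un[OF P(2), of f m] P(1) by (simp add: pair_sum_shift algebra_simps)
  have "pair_sum f D n = f (n - int x - int y) + pair_sum f D (n - int (i' + j'))"
    using pair_sum_Un[OF D(2), of f n] D(1) pair_sum_singleton[OF f]
    by (simp add: pair_sum_shift algebra_simps)
  then show ?thesis
    using PD[of n] PD[of "n - int (i' + j')"] by simp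
qed

lemma all_ge_1_iff: "(\<forall>i\<ge>1. P i) \<longleftrightarrow> P 1 \<and> (\<forall>i\<ge>1. P (Suc i))" for P :: "nat \<Rightarrow> bool"
proof safe
  fix i :: nat
  assume "P 1" and step: "\<forall>i\<ge>1. P (Suc i)" and "i \<ge> 1"
  then show "P i"
    by (cases "i = 1") (use step[rule_format, of "i - 1"] in simp_all)
qed auto

lemma Cons_Cons_mem_A_set:
  "x # y # c \<in> A_set N k \<longleftrightarrow>
     0 < x \<and> 0 < y \<and> int y + k < int x \<and> x + y \<le> N \<and> c \<in> A_set (N - (x + y)) k"
proof -
  let ?P = "\<lambda>c i. 2 * i \<le> length c \<longrightarrow> int (c ! (2 * i - 2)) > int (c ! (2 * i - 1)) + k"
  \<comment> \<open>Dropping two parts keeps the parity of positions, so each condition on the tail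
    is one on the whole list with its index lowered by one.\<close>
  have "?P (x # y # c) (Suc i) \<longleftrightarrow> ?P c i" if "i \<ge> 1" for i
    using that by (cases i) simp_all
  then have "(\<forall>i\<ge>1. ?P (x # y # c) i) \<longleftrightarrow> int x > int y + k \<and> (\<forall>i\<ge>1. ?P c i)"
    by (subst all_ge_1_iff) simp
  moreover have "x # y # c \<in> compositions N \<longleftrightarrow>
      0 < x \<and> 0 < y \<and> x + y \<le> N \<and> c \<in> compositions (N - (x + y))"
    by (auto simp: compositions_def)
  ultimately show ?thesis
    unfolding A_set_def by blast
qed

lemma a_num_eq_pair_sum:
  assumes "n \<ge> 0"
  shows "a_num n k
       = 1 + pair_sum (\<lambda>m. a_num m k) {(x, y). 0 < x \<and> 0 < y \<and> int y + k < int x} n"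
proof -
  define N where "N = nat n"
  have n: "n = int N" using assms by (simp add: N_def)
  define S where "S = {(x, y). (0 < x \<and> 0 < y \<and> int y + k < int x) \<and> int x + int y \<le> n}"
  define B where "B = (\<lambda>(x, y). (\<lambda>c. x # y # c) ` A_set (N - (x + y)) k)"
  \<comment> \<open>The unique element with fewer than two parts; it accounts for the summand
    1.\<close>
  define s where "s = (if N = 0 then [] else [N])"
  have finS: "finite S"
    using finite_pairs_le[of "{(x, y). 0 < x \<and> 0 < y \<and> int y + k < int x}" n]
    by (simp add: S_def)
  have finB: "finite (B p)" for p
    by (auto simp: B_def finite_A_set split: prod.split)
  have "c \<in> A_set N k \<longleftrightarrow> c \<in> insert s (\<Union>p\<in>S. B p)" for c
  proof (cases c)
    case Nil
    then show ?thesis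
      by (auto simp: A_set_def compositions_def s_def B_def)
  next
    case (Cons x c')
    then show ?thesis
    proof (cases c')
      case Nil
      then show ?thesis
        using Cons by (auto simp: A_set_def compositions_def s_def B_def)
    next
      case (Cons y r)
      then show ?thesis
        using \<open>c = x # c'\<close>
        by (auto simp: Cons_Cons_mem_A_set s_def B_def S_def n image_iff)
    qed
  qed
  then have "A_set N k = insert s (\<Union>p\<in>S. B p)" by blast
  moreover have "s \<notin> (\<Union>p\<in>S. B p)" by (auto simp: s_def B_def)
  ultimately have "card (A_set N k) = Suc (card (\<Union>p\<in>S. B p))"
    using finS finB by simp
  also have "card (\<Union>p\<in>S. B p) = (\<Sum>p\<in>S. card (B p))"
    \<comment> \<open>Disjointness holds because the first two parts of a list recover
      \<open>p\<close>.\<close>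
    by (rule card_UN_disjoint) (use finS finB in \<open>auto simp: B_def\<close>)
  finally have "a_num n k = 1 + (\<Sum>p\<in>S. int (card (B p)))"
    by (simp add: a_num_def n)
  also have "(\<Sum>p\<in>S. int (card (B p))) = (\<Sum>(x, y)\<in>S. a_num (n - int x - int y) k)"
  proof (rule sum.cong[OF refl])
    fix p assume p: "p \<in> S"
    obtain x y where xy: "p = (x, y)" by fastforce
    have "x + y \<le> N" using p by (auto simp: xy S_def n)
    then have "n - int x - int y = int (N - (x + y))" by (simp add: n)
    moreover have "card (B p) = card (A_set (N - (x + y)) k)"
      by (simp add: B_def xy card_image inj_on_def)
    ultimately show "int (card (B p)) = (case p of (x, y) \<Rightarrow> a_num (n - int x - int y) k)"
      by (simp add: xy a_num_def)
  qed
  finally show ?thesis by (simp add: pair_sum_def S_def)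
qed

lemma a_num_rec_nonneg:
  assumes "n \<ge> 3" "k \<ge> 0"
  shows "a_num n k = a_num (n - 1) k + a_num (n - 2) k - a_num (n - 3) k + a_num (n - 3 - k) k"
proof -
  define Q where "Q = {(x, y). 0 < x \<and> 0 < y \<and> int y + k < int x}"
  \<comment> \<open>Boundary ray of \<open>Q\<close>, from the apex \<open>(k + 2, 1)\<close> in
    direction \<open>(1, 1)\<close>; its translates by multiples of \<open>(1, 0)\<close> fill
    \<open>Q\<close>.\<close>
  define D where "D = {(x, y). 0 < y \<and> int x = int y + k + 1}"
  let ?f = "\<lambda>m. a_num m k"
  have "pair_sum ?f Q n - pair_sum ?f Q (n - int (1 + 0)) - pair_sum ?f Q (n - int (1 + 1))
      + pair_sum ?f Q (n - int (1 + 1) - int (1 + 0)) = ?f (n - int (nat (k + 2)) - int 1)"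
    by (rule pair_sum_cone[where D = D])
       (use assms in \<open>auto simp: a_num_def Q_def D_def mem_shift\<close>)
  \<comment> \<open>The constants cancel as 1 - 1 - 1 + 1 = 0, and \<open>n \<ge> 3\<close> keeps
    all four arguments nonnegative.\<close>
  then show ?thesis
    using assms a_num_eq_pair_sum[of n k] a_num_eq_pair_sum[of "n - 1" k]
      a_num_eq_pair_sum[of "n - 2" k] a_num_eq_pair_sum[of "n - 3" k]
    by (simp add: Q_def algebra_simps)
qed

lemma a_num_rec_nonpos:
  assumes "n \<ge> 3" "k \<le> 0"
  shows "a_num n k = a_num (n - 1) k + 2 * a_num (n - 2) k - a_num (n - 2 + k) k"
proof -
  define Q where "Q = {(x, y). 0 < x \<and> 0 < y \<and> int y + k < int x}"
  \<comment> \<open>The complement of \<open>Q\<close> in the quadrant \<open>T\<close>; here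
    \<open>0 < x\<close> and \<open>k \<le> 0\<close> force \<open>y\<close> to be positive.\<close>
  define E where "E = {(x, y). 0 < x \<and> int x \<le> int y + k}"
  define D where "D = {(x, y). 0 < x \<and> int x = int y + k}"
  define T :: "(nat \<times> nat) set" where "T = {(x, y). 0 < x \<and> 0 < y}"
  define C :: "(nat \<times> nat) set" where "C = {(x, y). x = 1 \<and> 0 < y}"
  let ?f = "\<lambda>m. a_num m k"
  have E: "pair_sum ?f E n - pair_sum ?f E (n - int (0 + 1)) - pair_sum ?f E (n - int (1 + 1))
      + pair_sum ?f E (n - int (1 + 1) - int (0 + 1)) = ?f (n - int 1 - int (nat (1 - k)))"
    by (rule pair_sum_cone[where D = D])
       (use assms in \<open>auto simp: a_num_def E_def D_def mem_shift\<close>)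
  have T: "pair_sum ?f T m - pair_sum ?f T (m - int (1 + 0)) - pair_sum ?f T (m - int (0 + 1))
      + pair_sum ?f T (m - int (0 + 1) - int (1 + 0)) = ?f (m - int 1 - int 1)" for m
    by (rule pair_sum_cone[where D = C])
       (auto simp: a_num_def T_def C_def mem_shift)
  have "T = Q \<union> E" "Q \<inter> E = {}"
    using assms by (auto simp: T_def Q_def E_def)
  then have QE: "pair_sum ?f T m = pair_sum ?f Q m + pair_sum ?f E m" for m
    using pair_sum_Un by metis
  \<comment> \<open>With \<open>s\<close> the shift from \<open>n\<close> to \<open>n - 1\<close>,
    the operator for \<open>T\<close> is \<open>(1 - s)(1 - s)\<close> and that for \<open>E\<close>
    is \<open>(1 - s)(1 - s s)\<close>. Adding the \<open>T\<close> equations at \<open>n\<close>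
    and \<open>n - 1\<close> multiplies the former by \<open>1 + s\<close>, so both operators agree
    and \<open>E\<close> can be subtracted.\<close>
  show ?thesis
    using assms E T[of n] T[of "n - 1"] QE[of n] QE[of "n - 1"] QE[of "n - 2"] QE[of "n - 3"]
      a_num_eq_pair_sum[of n k] a_num_eq_pair_sum[of "n - 1" k]
      a_num_eq_pair_sum[of "n - 2" k] a_num_eq_pair_sum[of "n - 3" k]
    by (simp add: Q_def algebra_simps)
qed

theorem theorem4p2:
  fixes n k :: int
  assumes "n \<ge> 3"
  shows "(k \<le> 0 \<longrightarrow> a_num n k = a_num (n - 1) k + 2 * a_num (n - 2) k - a_num (n - 2 + k) k)
       \<and> (k \<ge> 0 \<longrightarrow> a_num n k = a_num (n - 1) k + a_num (n - 2) k - a_num (n - 3) k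
                                + a_num (n - 3 - k) k)"
  using a_num_rec_nonneg a_num_rec_nonpos assms by blast

end
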